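(* For all $n,m\ge1$ there exists a matrix $E_{n+1}^{(m)}\in\mathbb R^{(n(m+1)+1)\times(n+1)^{m+1}}$ (the $m$-th L-eliminating matrix) such that for all $x\in\mathbb R$ $$E_{n+1}^{(m)}\,vec\left(X_n^{(m)}(x)\right)=H_{n(m+1)}(x).$$ In particular, $E_{n+1}^{(m)}$ is given by the recursion $$E_{n+1}^{(1)}=E_{n+1,n+1},\qquad E_{n+1}^{(m)}=E_{nm+1,n+1}\left(I_{n+1}\otimes E_{n+1}^{(m-1)}\right)\quad(m\ge2).$$
   Context: $H_n(x)=(1,x,\dots,x^n)^{\top}$. $\otimes$ is the Kronecker product, $I_k$ the $k\times k$ identity, $\vec e_{k,j}$ the $j$-th canonical basis (column) vector of $\mathbb R^k$. $X_n^{(m)}(x):=(H_n(x)^{\top})^{\otimes m}\otimes H_n(x)\in\mathbb R^{(n+1)\times(n+1)^m}$. $vec$ stacks the columns of a matrix into one column vector. For $a,c\ge1$ the L-eliminating matrix is $$E_{a,c}=\sum_{i=1}^{a}\vec e_{a+c-1,i}\otimes\vec e_{c,1}^{\top}\otimes\vec e_{a,i}^{\top}+\sum_{i=2}^{c}\vec e_{a+c-1,a+i-1}\otimes\vec e_{c,i}^{\top}\otimes\vec e_{a,a}^{\top}\in\mathbb R^{(a+c-1)\times ac}$$ (equivalently, $E_{a,c}vec(A)$ is, for $A\in\mathbb R^{a\times c}$, the vector formed by the first column of $A$ followed by entries $2,\dots,c$ of its last row). *)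

theory Defs
  imports "Jordan_Normal_Form.Matrix"
begin

text \<open>Column vectors are matrices with one column, so that the Kronecker product applies to
  vectors and matrices alike. Library indices are 0-based.\<close>

definition kron :: "real mat \<Rightarrow> real mat \<Rightarrow> real mat"  (infixl \<open>\<otimes>\<^sub>K\<close> 70) where
  "A \<otimes>\<^sub>K B = mat (dim_row A * dim_row B) (dim_col A * dim_col B)
     (\<lambda>(i, j). A $$ (i div dim_row B, j div dim_col B) * B $$ (i mod dim_row B, j mod dim_col B))"

primrec kron_pow :: "real mat \<Rightarrow> nat \<Rightarrow> real mat" where
  "kron_pow A 0 = 1\<^sub>m 1"
| "kron_pow A (Suc m) = A \<otimes>\<^sub>K kron_pow A m"

text \<open>The vec operator, i.e. column stacking; named differently because the library already uses
  \<open>vec\<close>.\<close>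

definition vec_stack :: "real mat \<Rightarrow> real mat" where
  "vec_stack A = mat (dim_row A * dim_col A) 1 (\<lambda>(k, _). A $$ (k mod dim_row A, k div dim_row A))"

definition H :: "nat \<Rightarrow> real \<Rightarrow> real mat" where
  "H n x = mat (n + 1) 1 (\<lambda>(i, _). x ^ i)"

definition X :: "nat \<Rightarrow> nat \<Rightarrow> real \<Rightarrow> real mat" where
  "X n m x = kron_pow ((H n x)\<^sup>T) m \<otimes>\<^sub>K H n x"

text \<open>The canonical basis column vector of dimension \<open>k\<close>, with the 1-based index \<open>j\<close> ranging over
  \<open>1, \<dots>, k\<close>.\<close>

definition basis_col :: "nat \<Rightarrow> nat \<Rightarrow> real mat" where
  "basis_col k j = mat_of_cols k [unit_vec k (j - 1)]"

text \<open>The type \<^typ>\<open>real mat\<close> has no zero shared by all dimensions, so the sums are taken in the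
  additive group of matrices of the fixed size \<open>(a + c - 1) \<times> ac\<close>.\<close>

definition L_elim :: "nat \<Rightarrow> nat \<Rightarrow> real mat" where
  "L_elim a c =
     (let M = module_mat TYPE(real) (a + c - 1) (a * c) in
       (\<Oplus>\<^bsub>M\<^esub> i \<in> {1..a}.
          basis_col (a + c - 1) i \<otimes>\<^sub>K (basis_col c 1)\<^sup>T \<otimes>\<^sub>K (basis_col a i)\<^sup>T) +
       (\<Oplus>\<^bsub>M\<^esub> i \<in> {2..c}.
          basis_col (a + c - 1) (a + i - 1) \<otimes>\<^sub>K (basis_col c i)\<^sup>T \<otimes>\<^sub>K (basis_col a a)\<^sup>T))"

end

theory Submission
  imports Defs
begin

text \<open>Column stacking turns a row factor on the left into a column factor, so
  \<open>vec (X n (m + 1)) = H n \<otimes> vec (X n m)\<close>. By the mixed product rule \<open>I \<otimes> E\<close> therefore sends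
  \<open>vec (X n (m + 1))\<close> to \<open>H n \<otimes> H (n (m + 1))\<close>, which stacks the matrix with entries \<open>x ^ (i + j)\<close>.
  The first column and the last row of that matrix contain each power once.\<close>

section \<open>Algebra of the Kronecker product\<close>

lemma dim_row_kron [simp]: "dim_row (A \<otimes>\<^sub>K B) = dim_row A * dim_row B"
  and dim_col_kron [simp]: "dim_col (A \<otimes>\<^sub>K B) = dim_col A * dim_col B"
  by (simp_all add: kron_def)

lemma index_kron:
  assumes "i < dim_row A * dim_row B" "j < dim_col A * dim_col B"
  shows "(A \<otimes>\<^sub>K B) $$ (i, j) =
    A $$ (i div dim_row B, j div dim_col B) * B $$ (i mod dim_row B, j mod dim_col B)"
  using assms by (simp add: kron_def)

lemma mod_less_of_less_mult: "i mod b < b" if "i < a * b" for a b i :: nat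
  using that by (cases "b = 0") auto

text \<open>Uniqueness of quotient and remainder. It turns an equation for a flat index into one
  equation for each of its two coordinates.\<close>

lemma eq_mult_add_iff: "j = u * a + v \<longleftrightarrow> j div a = u \<and> j mod a = v" if "v < a" for a j u v :: nat
proof -
  have "(u * a + v) div a = u" "(u * a + v) mod a = v" using that by simp_all
  thus ?thesis by (metis div_mult_mod_eq)
qed

text \<open>Both groupings read an index as the same three digits in mixed radix, one digit for each
  factor. \<open>split\<close> and \<open>div2\<close> say that the digits do not depend on whether
  the two lower or the two upper ones are separated first.\<close>

lemma kron_assoc: "(A \<otimes>\<^sub>K B) \<otimes>\<^sub>K C = A \<otimes>\<^sub>K (B \<otimes>\<^sub>K C)"
proof (rule eq_matI)
  fix i j
  assume "i < dim_row (A \<otimes>\<^sub>K (B \<otimes>\<^sub>K C))" "j < dim_col (A \<otimes>\<^sub>K (B \<otimes>\<^sub>K C))"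
  hence i: "i < dim_row A * (dim_row B * dim_row C)" "i < dim_row A * dim_row B * dim_row C"
    and j: "j < dim_col A * (dim_col B * dim_col C)" "j < dim_col A * dim_col B * dim_col C"
    by (simp_all add: mult.assoc)
  have split: "k div c mod b = k mod (b * c) div c \<and> k mod (b * c) mod c = k mod c" for k b c :: nat
    using mod_mult2_eq[of k c b] by (cases "c = 0") (auto simp: mult.commute)
  have div2: "k div c div b = k div (b * c)" for k b c :: nat
    by (metis div_mult2_eq mult.commute)
  show "((A \<otimes>\<^sub>K B) \<otimes>\<^sub>K C) $$ (i, j) = (A \<otimes>\<^sub>K (B \<otimes>\<^sub>K C)) $$ (i, j)"
    using i j mod_less_of_less_mult[OF i(1)] mod_less_of_less_mult[OF j(1)]
    by (simp add: index_kron less_mult_imp_div_less split div2)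
qed (simp_all add: mult.assoc)

text \<open>The range is cut into \<open>p\<close> consecutive blocks of length \<open>q\<close>. On
  block \<open>m\<close> the quotient is constantly \<open>m\<close> while the remainder runs
  through all of \<open>{..<q}\<close>, so the sum is a double sum that factors.\<close>

lemma sum_div_mod:
  fixes f g :: "nat \<Rightarrow> 'a::semiring_0"
  shows "(\<Sum>k<p * q. f (k div q) * g (k mod q)) = sum f {..<p} * sum g {..<q}"
proof -
  have "(\<Sum>k<p * q. f (k div q) * g (k mod q))
      = (\<Sum>m<p. \<Sum>k = m * q..<m * q + q. f (k div q) * g (k mod q))"
    by (rule sum.nat_group[symmetric])
  also have "\<dots> = (\<Sum>m<p. \<Sum>k<q. f m * g k)"
  proof (rule sum.cong[OF refl])
    fix m
    have "(\<Sum>k = m * q..<m * q + q. f (k div q) * g (k mod q))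
        = (\<Sum>k = 0..<q. f ((k + m * q) div q) * g ((k + m * q) mod q))"
      using sum.shift_bounds_nat_ivl[of "\<lambda>k. f (k div q) * g (k mod q)" 0 "m * q" q]
      by (simp add: add.commute)
    also have "\<dots> = (\<Sum>k<q. f m * g k)"
      unfolding lessThan_atLeast0 by (rule sum.cong) auto
    finally show "(\<Sum>k = m * q..<m * q + q. f (k div q) * g (k mod q)) = (\<Sum>k<q. f m * g k)" .
  qed
  finally show ?thesis by (simp add: sum_product)
qed

lemma index_mult_mat_sum:
  assumes "i < dim_row A" "j < dim_col B" "dim_col A = dim_row B"
  shows "(A * B) $$ (i, j) = (\<Sum>k<dim_row B. A $$ (i, k) * B $$ (k, j))"
  using assms by (simp add: scalar_prod_def lessThan_atLeast0)

text \<open>The summation index of the matrix product splits into an index for \<open>A * C\<close>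
  and one for \<open>B * D\<close>. Each summand is a product of a term in the first and a term in
  the second, so \<open>sum_div_mod\<close> applies.\<close>

lemma kron_mult_kron:
  assumes "dim_col A = dim_row C" "dim_col B = dim_row D"
  shows "(A \<otimes>\<^sub>K B) * (C \<otimes>\<^sub>K D) = (A * C) \<otimes>\<^sub>K (B * D)"
proof (rule eq_matI)
  fix i j
  assume "i < dim_row ((A * C) \<otimes>\<^sub>K (B * D))" "j < dim_col ((A * C) \<otimes>\<^sub>K (B * D))"
  hence i: "i < dim_row A * dim_row B" and j: "j < dim_col C * dim_col D" by simp_all
  let ?f = "\<lambda>k. A $$ (i div dim_row B, k) * C $$ (k, j div dim_col D)"
  let ?g = "\<lambda>k. B $$ (i mod dim_row B, k) * D $$ (k, j mod dim_col D)"
  have "((A \<otimes>\<^sub>K B) * (C \<otimes>\<^sub>K D)) $$ (i, j)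
      = (\<Sum>k<dim_row C * dim_row D. (A \<otimes>\<^sub>K B) $$ (i, k) * (C \<otimes>\<^sub>K D) $$ (k, j))"
    using i j assms by (subst index_mult_mat_sum) simp_all
  also have "\<dots> = (\<Sum>k<dim_row C * dim_row D. ?f (k div dim_row D) * ?g (k mod dim_row D))"
  proof (rule sum.cong[OF refl])
    fix k assume "k \<in> {..<dim_row C * dim_row D}"
    thus "(A \<otimes>\<^sub>K B) $$ (i, k) * (C \<otimes>\<^sub>K D) $$ (k, j) = ?f (k div dim_row D) * ?g (k mod dim_row D)"
      using i j assms by (simp add: index_kron)
  qed
  also have "\<dots> = sum ?f {..<dim_row C} * sum ?g {..<dim_row D}" by (rule sum_div_mod)
  also have "\<dots> = ((A * C) \<otimes>\<^sub>K (B * D)) $$ (i, j)"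
    using i j assms mod_less_of_less_mult[OF i] mod_less_of_less_mult[OF j]
    by (simp add: index_kron index_mult_mat_sum less_mult_imp_div_less
        del: index_mult_mat(1))
  finally show "((A \<otimes>\<^sub>K B) * (C \<otimes>\<^sub>K D)) $$ (i, j) = ((A * C) \<otimes>\<^sub>K (B * D)) $$ (i, j)" .
qed simp_all

lemma kron_one: "1\<^sub>m a \<otimes>\<^sub>K 1\<^sub>m b = 1\<^sub>m (a * b)"
proof (rule eq_matI)
  fix i j
  assume "i < dim_row (1\<^sub>m (a * b))" "j < dim_col (1\<^sub>m (a * b))"
  hence i: "i < a * b" and j: "j < a * b" by simp_all
  have "i = j \<longleftrightarrow> i div b = j div b \<and> i mod b = j mod b"
    by (metis div_mult_mod_eq)
  thus "(1\<^sub>m a \<otimes>\<^sub>K 1\<^sub>m b) $$ (i, j) = (1\<^sub>m (a * b) :: real mat) $$ (i, j)"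
    using i j mod_less_of_less_mult[OF i] mod_less_of_less_mult[OF j]
    by (simp add: index_kron less_mult_imp_div_less)
qed simp_all

section \<open>Column stacking and the matrices \<open>X\<close>\<close>

lemma vec_stack_kron_row:
  assumes "dim_row R = 1"
  shows "vec_stack (R \<otimes>\<^sub>K A) = R\<^sup>T \<otimes>\<^sub>K vec_stack A"
proof (rule eq_matI)
  fix i j
  assume "i < dim_row (R\<^sup>T \<otimes>\<^sub>K vec_stack A)" "j < dim_col (R\<^sup>T \<otimes>\<^sub>K vec_stack A)"
  hence i: "i < dim_col R * (dim_row A * dim_col A)" and j: "j = 0"
    using assms by (simp_all add: vec_stack_def)
  from i have i': "i < dim_row A * (dim_col R * dim_col A)" "i < (dim_col R * dim_col A) * dim_row A"
    by (simp_all add: mult_ac)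
  have d: "i div dim_row A < dim_col R * dim_col A"
    using i'(2) by (rule less_mult_imp_div_less)
  \<comment> \<open>The digits of \<open>i\<close>, from high to low, are a column of
    \<open>R\<close>, a column of \<open>A\<close> and a row of \<open>A\<close>. Stacking splits
    off the lowest digit first, the Kronecker product on the right-hand side the highest.\<close>
  have "i mod (dim_row A * dim_col A) div dim_row A = i div dim_row A mod dim_col A"
    "i mod (dim_row A * dim_col A) mod dim_row A = i mod dim_row A"
    using mod_mult2_eq[of i "dim_row A" "dim_col A"] mod_less_of_less_mult[OF i'(2)]
    by simp_all
  thus "vec_stack (R \<otimes>\<^sub>K A) $$ (i, j) = (R\<^sup>T \<otimes>\<^sub>K vec_stack A) $$ (i, j)"
    using i i' j d assms mod_less_of_less_mult[OF i] mod_less_of_less_mult[OF i'(2)]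
    by (simp add: index_kron vec_stack_def less_mult_imp_div_less div_mult2_eq)
qed (use assms in \<open>simp_all add: vec_stack_def mult_ac\<close>)

lemma vec_stack_col: "vec_stack A = A" if "dim_col A = 1"
  using that by (intro eq_matI) (simp_all add: vec_stack_def)

lemma dim_H [simp]: "dim_row (H n x) = n + 1" "dim_col (H n x) = 1"
  by (simp_all add: H_def)

lemma index_H [simp]: "i \<le> n \<Longrightarrow> H n x $$ (i, 0) = x ^ i"
  by (simp add: H_def)

lemma vec_stack_X_0: "vec_stack (X n 0 x) = H n x"
proof -
  have "X n 0 x = H n x"
    unfolding X_def by (rule eq_matI) (simp_all add: index_kron)
  thus ?thesis by (simp add: vec_stack_col)
qed

text \<open>Associativity isolates the first row factor of \<open>X n (Suc m) x\<close>, and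
  stacking transposes that factor back to \<open>H n x\<close>.\<close>

lemma vec_stack_X_Suc: "vec_stack (X n (Suc m) x) = H n x \<otimes>\<^sub>K vec_stack (X n m x)"
  by (simp add: X_def kron_assoc vec_stack_kron_row)

lemma dim_vec_stack_X: "dim_row (vec_stack (X n m x)) = (n + 1) ^ (m + 1)"
  by (induction m) (simp_all add: vec_stack_X_0 vec_stack_X_Suc)

section \<open>Entries of the L-eliminating matrix\<close>

lemma finsum_module_mat:
  assumes "finite S" "\<And>s. s \<in> S \<Longrightarrow> f s \<in> carrier_mat r c"
  shows "finsum (module_mat TYPE('a::comm_ring_1) r c) f S = mat r c (\<lambda>ij. \<Sum>s\<in>S. f s $$ ij)"
  using assms
proof (induction S rule: finite_induct)
  case empty
  interpret M: abelian_group "module_mat TYPE('a) r c" by (rule abelian_group_mat)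
  \<comment> \<open>The empty sum is the zero matrix of the fixed size. The second sum in
    \<open>L_elim a c\<close> is of this kind when \<open>c = 1\<close>.\<close>
  show ?case by (auto simp: module_mat_simps)
next
  case (insert s S)
  interpret M: abelian_group "module_mat TYPE('a) r c" by (rule abelian_group_mat)
  from insert.prems have "f \<in> S \<rightarrow> carrier (module_mat TYPE('a) r c)"
    "f s \<in> carrier (module_mat TYPE('a) r c)"
    by (auto simp: module_mat_simps)
  from M.finsum_insert[OF insert.hyps this] insert
  show ?case by (auto simp: module_mat_simps intro!: eq_matI)
qed

lemma dim_basis_col [simp]: "dim_row (basis_col k j) = k" "dim_col (basis_col k j) = 1"
  by (simp_all add: basis_col_def)

text \<open>These products are matrix units: a column basis vector fixes the row, and two row basis
  vectors fix the two digits of the column. Subtracting 1 passes from 1-based to 0-based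
  indices.\<close>

lemma index_kron_basis:
  assumes "1 \<le> p" "p \<le> r" "1 \<le> q" "q \<le> c" "1 \<le> s" "s \<le> a" "i < r" "j < a * c"
  shows "(basis_col r p \<otimes>\<^sub>K (basis_col c q)\<^sup>T \<otimes>\<^sub>K (basis_col a s)\<^sup>T) $$ (i, j) =
    (if i = p - 1 \<and> j = (q - 1) * a + (s - 1) then 1 else 0)"
proof -
  have j: "j < c * a" using assms by (simp add: mult.commute)
  have basis: "t < k \<Longrightarrow> basis_col k l $$ (t, 0) = (if t = l - 1 then 1 else 0)" if "1 \<le> l" "l \<le> k" for k l t
    using that by (auto simp: basis_col_def mat_of_cols_def)
  have "j = (q - 1) * a + (s - 1) \<longleftrightarrow> j div a = q - 1 \<and> j mod a = s - 1"
    by (rule eq_mult_add_iff) (use assms in simp)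
  thus ?thesis
    using assms j mod_less_of_less_mult[OF j]
    by (simp add: index_kron basis less_mult_imp_div_less)
qed

text \<open>Each row has a single 1. In the stacking of an \<open>a\<close> by \<open>c\<close>
  matrix, column \<open>i < a\<close> is entry \<open>i\<close> of the first matrix column, and
  column \<open>(i + 1 - a) * a + (a - 1)\<close> is entry \<open>i + 1 - a\<close> of the last
  matrix row, both counted from 0.\<close>

lemma L_elim_eq:
  assumes "a \<ge> 1" "c \<ge> 1"
  shows "L_elim a c = mat (a + c - 1) (a * c)
    (\<lambda>(i, j). if j = (if i < a then i else (i + 1 - a) * a + (a - 1)) then 1 else 0)"
proof -
  define F where "F s = basis_col (a + c - 1) s \<otimes>\<^sub>K (basis_col c 1)\<^sup>T \<otimes>\<^sub>K (basis_col a s)\<^sup>T" for s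
  define G where "G s = basis_col (a + c - 1) (a + s - 1) \<otimes>\<^sub>K (basis_col c s)\<^sup>T \<otimes>\<^sub>K (basis_col a a)\<^sup>T"
    for s
  have F: "F s \<in> carrier_mat (a + c - 1) (a * c)" and G: "G s \<in> carrier_mat (a + c - 1) (a * c)" for s
    unfolding F_def G_def by auto
  have "L_elim a c = finsum (module_mat TYPE(real) (a + c - 1) (a * c)) F {1..a}
      + finsum (module_mat TYPE(real) (a + c - 1) (a * c)) G {2..c}"
    unfolding L_elim_def Let_def F_def[abs_def] G_def[abs_def] by (rule refl)
  also have "\<dots> = mat (a + c - 1) (a * c) (\<lambda>ij. \<Sum>s = 1..a. F s $$ ij)
      + mat (a + c - 1) (a * c) (\<lambda>ij. \<Sum>s = 2..c. G s $$ ij)"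
    by (simp only: finsum_module_mat[OF finite_atLeastAtMost F]
        finsum_module_mat[OF finite_atLeastAtMost G])
  also have "\<dots> = mat (a + c - 1) (a * c)
    (\<lambda>(i, j). if j = (if i < a then i else (i + 1 - a) * a + (a - 1)) then 1 else 0)"
    (is "?S = mat _ _ ?e")
  proof (rule eq_matI)
    fix i j
    assume "i < dim_row (mat (a + c - 1) (a * c) ?e)" "j < dim_col (mat (a + c - 1) (a * c) ?e)"
    hence i: "i < a + c - 1" and j: "j < a * c" by simp_all
    have "(\<Sum>s = 1..a. F s $$ (i, j)) = (\<Sum>s = 1..a. if s = i + 1 then (if j = i then 1 else 0) else 0)"
    proof (rule sum.cong[OF refl])
      fix s assume s: "s \<in> {1..a}"
      have "F s $$ (i, j) = (if i = s - 1 \<and> j = (1 - 1) * a + (s - 1) then 1 else 0)"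
        unfolding F_def by (rule index_kron_basis) (use s i j assms in auto)
      thus "F s $$ (i, j) = (if s = i + 1 then (if j = i then 1 else 0) else 0)"
        using s by auto
    qed
    also have "\<dots> = (if i < a \<and> j = i then 1 else 0)" by simp
    finally have F: "(\<Sum>s = 1..a. F s $$ (i, j)) = (if i < a \<and> j = i then 1 else 0)" .
    \<comment> \<open>Summand \<open>s\<close> lives in row \<open>a + s - 2\<close>, which gives
      \<open>s = i + 2 - a\<close>. As \<open>s\<close> is at least 2, only rows with
      \<open>a \<le> i\<close> are hit, so the two sums fill disjoint sets of rows.\<close>
    have "(\<Sum>s = 2..c. G s $$ (i, j)) =
      (\<Sum>s = 2..c. if s = i + 2 - a then
        (if a \<le> i \<and> j = (i + 1 - a) * a + (a - 1) then 1 else 0) else 0)"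
    proof (rule sum.cong[OF refl])
      fix s assume s: "s \<in> {2..c}"
      have "G s $$ (i, j) = (if i = a + s - 1 - 1 \<and> j = (s - 1) * a + (a - 1) then 1 else 0)"
        unfolding G_def by (rule index_kron_basis) (use s i j assms in auto)
      moreover have "i = a + s - 1 - 1 \<longleftrightarrow> s = i + 2 - a \<and> a \<le> i"
        using s by auto
      moreover have "s - 1 = i + 1 - a" if "s = i + 2 - a" "a \<le> i"
        using that by simp
      ultimately show "G s $$ (i, j) = (if s = i + 2 - a then
        (if a \<le> i \<and> j = (i + 1 - a) * a + (a - 1) then 1 else 0) else 0)"
        by presburger
    qed
    \<comment> \<open>For \<open>a \<le> i\<close>, the bound \<open>i < a + c - 1\<close> places
      \<open>i + 2 - a\<close> in \<open>{2..c}\<close>, so exactly one index survives.\<close>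
    also have "\<dots> = (if a \<le> i \<and> j = (i + 1 - a) * a + (a - 1) then 1 else 0)"
      using i assms by auto
    finally have G: "(\<Sum>s = 2..c. G s $$ (i, j)) =
      (if a \<le> i \<and> j = (i + 1 - a) * a + (a - 1) then 1 else 0)" .
    have "?S $$ (i, j) = (\<Sum>s = 1..a. F s $$ (i, j)) + (\<Sum>s = 2..c. G s $$ (i, j))"
      using i j by simp
    also have "\<dots> = ?e (i, j)" unfolding F G by simp
    finally show "?S $$ (i, j) = mat (a + c - 1) (a * c) ?e $$ (i, j)"
      using i j by simp
  qed simp_all
  finally show ?thesis .
qed

lemma L_elim_carrier: "a \<ge> 1 \<Longrightarrow> c \<ge> 1 \<Longrightarrow> L_elim a c \<in> carrier_mat (a + c - 1) (a * c)"
  by (simp add: L_elim_eq)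

text \<open>Row \<open>i\<close> picks the entry at position \<open>(i, 0)\<close> if
  \<open>i \<le> k\<close>, and at \<open>(k, i - k)\<close> otherwise. Either way the two
  coordinates add up to \<open>i\<close>, so the entry is \<open>x ^ i\<close>.\<close>

lemma L_elim_mult_H: "L_elim (k + 1) (n + 1) * (H n x \<otimes>\<^sub>K H k x) = H (k + n) x"
proof (rule eq_matI)
  fix i j
  assume "i < dim_row (H (k + n) x)" "j < dim_col (H (k + n) x)"
  hence i: "i \<le> k + n" and j: "j = 0" by simp_all
  \<comment> \<open>The column of the only 1 in row \<open>i\<close>, from \<open>L_elim_eq\<close>
    with \<open>a = k + 1\<close>.\<close>
  define q where "q = (if i \<le> k then i else (i - k) * (k + 1) + k)"
  have "q \<le> n * (k + 1) + k"
  proof (cases "i \<le> k")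
    case False
    have "(i - k) * (k + 1) \<le> n * (k + 1)"
      using i by (intro mult_right_mono) auto
    thus ?thesis using False by (simp add: q_def)
  qed (simp add: q_def)
  hence q: "q < (n + 1) * (k + 1)" by simp
  \<comment> \<open>Quotient and remainder of \<open>q\<close> are the exponents contributed by
    \<open>H n x\<close> and \<open>H k x\<close>.\<close>
  have decomp: "q div (k + 1) + q mod (k + 1) = i"
  proof (cases "i \<le> k")
    case False
    have "q div (k + 1) = i - k \<and> q mod (k + 1) = k"
      by (subst eq_mult_add_iff[symmetric]) (use False in \<open>simp_all add: q_def\<close>)
    thus ?thesis using False by simp
  qed (simp add: q_def)
  have L: "L_elim (k + 1) (n + 1) $$ (i, t) = (if t = q then 1 else 0)"
    if "t < (n + 1) * (k + 1)" for t
  proof -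
    have "i < k + 1 + (n + 1) - 1" "t < (k + 1) * (n + 1)"
      using i that by (simp_all only: mult.commute)
    moreover have "(if i < k + 1 then i else (i + 1 - (k + 1)) * (k + 1) + (k + 1 - 1)) = q"
      by (simp add: q_def)
    ultimately show ?thesis by (subst L_elim_eq) simp_all
  qed
  have "(L_elim (k + 1) (n + 1) * (H n x \<otimes>\<^sub>K H k x)) $$ (i, j)
      = (\<Sum>t<(n + 1) * (k + 1). L_elim (k + 1) (n + 1) $$ (i, t) * (H n x \<otimes>\<^sub>K H k x) $$ (t, 0))"
    using i j by (subst index_mult_mat_sum) (simp_all add: L_elim_eq)
  also have "\<dots> = (\<Sum>t<(n + 1) * (k + 1). if t = q then (H n x \<otimes>\<^sub>K H k x) $$ (t, 0) else 0)"
    by (intro sum.cong refl, subst L) auto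
  also have "\<dots> = (H n x \<otimes>\<^sub>K H k x) $$ (q, 0)" using q by simp
  also have "\<dots> = x ^ (q div (k + 1)) * x ^ (q mod (k + 1))"
  proof -
    have "q div (k + 1) < n + 1" "q mod (k + 1) < k + 1"
      using less_mult_imp_div_less[OF q] by simp_all
    thus ?thesis using q by (simp add: index_kron)
  qed
  also have "\<dots> = H (k + n) x $$ (i, j)"
    using i j decomp by (simp flip: power_add)
  finally show "(L_elim (k + 1) (n + 1) * (H n x \<otimes>\<^sub>K H k x)) $$ (i, j) = H (k + n) x $$ (i, j)" .
qed (simp_all add: L_elim_eq)

section \<open>The iterated L-eliminating matrices\<close>

text \<open>Starting at \<open>m = 0\<close>, where \<open>vec (X n 0) = H n\<close>, makes the case \<open>m = 1\<close> an instance of the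
  recursion.\<close>

primrec L_elim_iter :: "nat \<Rightarrow> nat \<Rightarrow> real mat" where
  "L_elim_iter N 0 = 1\<^sub>m N"
| "L_elim_iter N (Suc m) = L_elim ((N - 1) * Suc m + 1) N * (1\<^sub>m N \<otimes>\<^sub>K L_elim_iter N m)"

text \<open>The number of rows is read off the outermost \<open>L_elim\<close>, so only the number
  of columns needs an induction.\<close>

lemma L_elim_iter_carrier:
  "L_elim_iter (n + 1) m \<in> carrier_mat (n * (m + 1) + 1) ((n + 1) ^ (m + 1))"
proof (cases m)
  case 0
  thus ?thesis by simp
next
  case (Suc k)
  have "dim_col (L_elim_iter (n + 1) k) = (n + 1) ^ (k + 1)"
    by (induction k) simp_all
  moreover have "dim_row (L_elim ((n + 1 - 1) * Suc k + 1) (n + 1)) = n * Suc k + 1 + (n + 1) - 1"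
    using L_elim_carrier[of "n * Suc k + 1" "n + 1"] by (simp del: mult_Suc_right)
  ultimately show ?thesis unfolding Suc by (intro carrier_matI) simp_all
qed

lemma L_elim_iter_mult_vec_stack_X:
  "L_elim_iter (n + 1) m * vec_stack (X n m x) = H (n * (m + 1)) x"
proof (induction m)
  case 0
  show ?case by (simp add: vec_stack_X_0)
next
  case (Suc m)
  define E where "E = L_elim_iter (n + 1) m"
  define L where "L = L_elim (n * Suc m + 1) (n + 1)"
  define v where "v = vec_stack (X n m x)"
  have E: "E \<in> carrier_mat (n * (m + 1) + 1) ((n + 1) ^ (m + 1))"
    unfolding E_def by (rule L_elim_iter_carrier)
  have L: "L \<in> carrier_mat (n * Suc m + 1 + (n + 1) - 1) ((n * Suc m + 1) * (n + 1))"
    unfolding L_def by (rule L_elim_carrier) simp_all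
  have v: "dim_row v = (n + 1) ^ (m + 1)" unfolding v_def by (rule dim_vec_stack_X)
  have IE: "1\<^sub>m (n + 1) \<otimes>\<^sub>K E \<in> carrier_mat ((n * Suc m + 1) * (n + 1)) ((n + 1) * (n + 1) ^ (m + 1))"
    using E by (intro carrier_matI) (simp_all only: dim_row_kron dim_col_kron index_one_mat
        carrier_matD mult.commute Suc_eq_plus1)
  have Hv: "H n x \<otimes>\<^sub>K v \<in> carrier_mat ((n + 1) * (n + 1) ^ (m + 1)) (dim_col v)"
    by (intro carrier_matI) (simp_all only: dim_row_kron dim_col_kron dim_H v mult_1)
  \<comment> \<open>Reassociating lets \<open>I \<otimes> E\<close> act on the Kronecker product
    first, where the mixed product rule and the induction hypothesis apply.\<close>
  have "L * (1\<^sub>m (n + 1) \<otimes>\<^sub>K E) * (H n x \<otimes>\<^sub>K v) = L * ((1\<^sub>m (n + 1) \<otimes>\<^sub>K E) * (H n x \<otimes>\<^sub>K v))"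
    by (rule assoc_mult_mat[OF L IE Hv])
  also have "(1\<^sub>m (n + 1) \<otimes>\<^sub>K E) * (H n x \<otimes>\<^sub>K v) = (1\<^sub>m (n + 1) * H n x) \<otimes>\<^sub>K (E * v)"
    by (rule kron_mult_kron) (simp_all only: index_one_mat dim_H carrier_matD[OF E] v)
  also have "1\<^sub>m (n + 1) * H n x = H n x" by (rule left_mult_one_mat, rule carrier_matI) simp_all
  also have "E * v = H (n * Suc m) x" using Suc.IH by (simp add: E_def v_def)
  also have "L * (H n x \<otimes>\<^sub>K H (n * Suc m) x) = H (n * Suc m + n) x"
    unfolding L_def by (rule L_elim_mult_H)
  finally show ?case by (simp add: E_def L_def v_def vec_stack_X_Suc ac_simps)
qed

theorem proposition4p2:
  shows "\<exists>E :: nat \<Rightarrow> nat \<Rightarrow> real mat.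
    (\<forall>n\<ge>1. \<forall>m\<ge>1.
       E (n + 1) m \<in> carrier_mat (n * (m + 1) + 1) ((n + 1) ^ (m + 1)) \<and>
       (\<forall>x::real. E (n + 1) m * vec_stack (X n m x) = H (n * (m + 1)) x)) \<and>
    (\<forall>n\<ge>1.
       E (n + 1) 1 = L_elim (n + 1) (n + 1) \<and>
       (\<forall>m\<ge>2. E (n + 1) m = L_elim (n * m + 1) (n + 1) * (1\<^sub>m (n + 1) \<otimes>\<^sub>K E (n + 1) (m - 1))))"
proof (rule exI[of _ L_elim_iter], intro conjI allI impI)
  fix n m :: nat
  show "L_elim_iter (n + 1) m \<in> carrier_mat (n * (m + 1) + 1) ((n + 1) ^ (m + 1))"
    by (rule L_elim_iter_carrier)
  show "L_elim_iter (n + 1) m * vec_stack (X n m x) = H (n * (m + 1)) x" for x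
    by (rule L_elim_iter_mult_vec_stack_X)
  \<comment> \<open>The recursion started at 0 yields \<open>E (n + 1) 1\<close> with an additional
    factor \<open>I \<otimes> I\<close>, which is an identity matrix and cancels.\<close>
  have "L_elim (n + 1) (n + 1) * 1\<^sub>m ((n + 1) * (n + 1)) = L_elim (n + 1) (n + 1)"
    by (rule right_mult_one_mat[OF L_elim_carrier]) simp_all
  thus "L_elim_iter (n + 1) 1 = L_elim (n + 1) (n + 1)"
    by (simp add: kron_one)
  show "L_elim_iter (n + 1) m
      = L_elim (n * m + 1) (n + 1) * (1\<^sub>m (n + 1) \<otimes>\<^sub>K L_elim_iter (n + 1) (m - 1))"
    if "2 \<le> m"
    using that by (cases m) simp_all
qed

end
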